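(* Let $\Phi\subset\mathbb{R}^n$ be an irreducible crystallographic root system with positive system $\Phi^+$ and corresponding simple system $\Delta\subseteq\Phi^+$, and let $W$ be the corresponding Weyl group. If $\alpha,\beta\in\Phi^+$ are incomparable, then there is $w\in W$ with $w\Delta\cap\Phi^+=\{\alpha,\beta\}$.
   Context: A root system is a finite nonempty set $\Phi\subset\mathbb{R}^n\setminus\{0\}$ with $\Phi\cap\mathbb{R}\alpha=\{-\alpha,\alpha\}$ and $s_\alpha(\Phi)=\Phi$ for all $\alpha\in\Phi$, where $s_\alpha(x)=x-2\frac{\alpha^tx}{\alpha^t\alpha}\alpha$. It is irreducible if it has no partition into two nonempty subsets $\Phi',\Phi''$ with $\alpha^t\beta=0$ for all $\alpha\in\Phi',\beta\in\Phi''$; it is crystallographic if $\frac{2\alpha^t\beta}{\alpha^t\alpha}\in\mathbb{Z}$ for all $\alpha,\beta\in\Phi$. The Weyl group $W$ is the group generated by the reflections $s_\alpha$, $\alpha\in\Phi$. A positive system is $\Phi^+=\Phi\cap\{x : c^tx>0\}$ for some $c\in\mathbb{R}^n$ with $c^t\alpha\neq0$ for all $\alpha\in\Phi$. The simple system $\Delta\subseteq\Phi^+$ is the unique minimal set of generators of the cone $C=\operatorname{cone}(\Phi^+)$. Write $\alpha\preceq\beta$ if $\beta-\alpha\in C$ (on $\Phi^+$ this is the root poset). Two roots $\alpha,\beta\in\Phi^+$ are incomparable if neither $\alpha-\beta$ nor $\beta-\alpha$ lies in $C$. *)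

theory Defs
  imports "HOL-Analysis.Analysis" "HOL-Algebra.Bij" "HOL-Algebra.Generated_Groups"
begin

definition reflection :: "'a::real_inner \<Rightarrow> 'a \<Rightarrow> 'a" where
  "reflection \<alpha> x = x - (2 * (\<alpha> \<bullet> x) / (\<alpha> \<bullet> \<alpha>)) *\<^sub>R \<alpha>"

text \<open>As in part of the literature, a root system is reduced by definition, but it need neither
  span the ambient space nor be crystallographic.\<close>

definition root_system :: "'a::real_inner set \<Rightarrow> bool" where
  "root_system \<Phi> \<longleftrightarrow>
     finite \<Phi> \<and> \<Phi> \<noteq> {} \<and> 0 \<notin> \<Phi> \<and>
     (\<forall>\<alpha>\<in>\<Phi>. \<Phi> \<inter> range (\<lambda>t. t *\<^sub>R \<alpha>) = {- \<alpha>, \<alpha>} \<and> reflection \<alpha> ` \<Phi> = \<Phi>)"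

definition irreducible_roots :: "'a::real_inner set \<Rightarrow> bool" where
  "irreducible_roots \<Phi> \<longleftrightarrow>
     \<not> (\<exists>\<Phi>1 \<Phi>2. \<Phi>1 \<noteq> {} \<and> \<Phi>2 \<noteq> {} \<and> \<Phi>1 \<inter> \<Phi>2 = {} \<and> \<Phi>1 \<union> \<Phi>2 = \<Phi> \<and>
          (\<forall>\<alpha>\<in>\<Phi>1. \<forall>\<beta>\<in>\<Phi>2. \<alpha> \<bullet> \<beta> = 0))"

definition crystallographic :: "'a::real_inner set \<Rightarrow> bool" where
  "crystallographic \<Phi> \<longleftrightarrow> (\<forall>\<alpha>\<in>\<Phi>. \<forall>\<beta>\<in>\<Phi>. 2 * (\<alpha> \<bullet> \<beta>) / (\<alpha> \<bullet> \<alpha>) \<in> \<int>)"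

definition weyl_group :: "'a::real_inner set \<Rightarrow> ('a \<Rightarrow> 'a) set" where
  "weyl_group \<Phi> = generate (BijGroup UNIV) (reflection ` \<Phi>)"

text \<open>The generators of the Weyl group lie in the carrier, as \<^const>\<open>generate\<close> expects.\<close>

lemma reflection_reflection: "reflection \<alpha> (reflection \<alpha> x) = x"
  by (cases "\<alpha> = 0") (simp_all add: reflection_def inner_diff_right)

lemma reflection_in_carrier_BijGroup: "reflection \<alpha> \<in> carrier (BijGroup UNIV)"
  by (simp add: BijGroup_def Bij_def o_bij[of "reflection \<alpha>"] fun_eq_iff reflection_reflection)

definition positive_system :: "'a::real_inner set \<Rightarrow> 'a set \<Rightarrow> bool" where
  "positive_system \<Phi> P \<longleftrightarrow>
     (\<exists>c. (\<forall>\<alpha>\<in>\<Phi>. c \<bullet> \<alpha> \<noteq> 0) \<and> P = \<Phi> \<inter> {x. c \<bullet> x > 0})"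

text \<open>The cone generated by a set of vectors consists of their non-negative combinations, hence
  \<^const>\<open>convex_cone\<close> rather than \<^const>\<open>cone\<close>, which does not require convexity.\<close>

definition simple_system :: "'a::real_inner set \<Rightarrow> 'a set \<Rightarrow> bool" where
  "simple_system P \<Delta> \<longleftrightarrow>
     \<Delta> \<subseteq> P \<and> convex_cone hull \<Delta> = convex_cone hull P \<and>
     (\<forall>S. S \<subset> \<Delta> \<longrightarrow> convex_cone hull S \<noteq> convex_cone hull P)"

definition root_le :: "'a::real_inner set \<Rightarrow> 'a \<Rightarrow> 'a \<Rightarrow> bool" where
  "root_le P \<alpha> \<beta> \<longleftrightarrow> \<beta> - \<alpha> \<in> convex_cone hull P"

definition incomparable_roots :: "'a::real_inner set \<Rightarrow> 'a \<Rightarrow> 'a \<Rightarrow> bool" where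
  "incomparable_roots P \<alpha> \<beta> \<longleftrightarrow> \<not> root_le P \<alpha> \<beta> \<and> \<not> root_le P \<beta> \<alpha>"

end

theory Submission
  imports Defs
begin

text \<open>
  Since \<open>\<alpha>\<close> and \<open>\<beta>\<close> are incomparable, \<open>\<alpha> \<bullet> \<beta> \<le> 0\<close> and they are the simple roots of the rank-two
  system that they span. Take a generic \<open>c\<close> defining \<open>P\<close>, let \<open>x\<close> be the negative of
  the projection of \<open>c\<close> to the orthogonal complement of \<open>\<alpha>\<close> and \<open>\<beta>\<close>, and let \<open>Q\<close> be the positive
  system of \<open>x + \<epsilon> c\<close> for small \<open>\<epsilon> > 0\<close>. Then \<open>\<alpha>\<close> and \<open>\<beta>\<close> are simple in \<open>Q\<close>. Moreover
  \<open>x = - c + a \<alpha> + b \<beta>\<close> with \<open>a, b > 0\<close>, and distinct simple roots form obtuse angles, so every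
  other simple root \<open>\<gamma>\<close> of \<open>Q\<close> satisfies \<open>0 \<le> x \<bullet> \<gamma> \<le> - (c \<bullet> \<gamma>)\<close> and is negative for \<open>P\<close>. Finally,
  the Weyl group acts transitively on positive systems.
\<close>

section \<open>Roots\<close>

lemma linear_reflection: "linear (reflection \<alpha>)"
  by (rule linearI) (simp_all add: reflection_def inner_add_right algebra_simps add_divide_distrib)

lemma root_uminus:
  assumes "root_system \<Phi>" "\<alpha> \<in> \<Phi>" shows "- \<alpha> \<in> \<Phi>"
  using assms unfolding root_system_def by blast

lemma root_nonzero:
  assumes "root_system \<Phi>" "\<alpha> \<in> \<Phi>" shows "\<alpha> \<noteq> 0"
  using assms unfolding root_system_def by blast

lemma reflection_image_roots:
  assumes "root_system \<Phi>" "\<alpha> \<in> \<Phi>" shows "reflection \<alpha> ` \<Phi> = \<Phi>"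
  using assms unfolding root_system_def by blast

lemma root_multiple:
  assumes "root_system \<Phi>" "\<alpha> \<in> \<Phi>" "t *\<^sub>R \<alpha> \<in> \<Phi>" shows "t = 1 \<or> t = -1"
proof -
  have "t *\<^sub>R \<alpha> \<in> \<Phi> \<inter> range (\<lambda>t. t *\<^sub>R \<alpha>)" using assms(3) by blast
  then have "t *\<^sub>R \<alpha> = - \<alpha> \<or> t *\<^sub>R \<alpha> = \<alpha>"
    using assms(1,2) unfolding root_system_def by blast
  then have "(t + 1) *\<^sub>R \<alpha> = 0 \<or> (t - 1) *\<^sub>R \<alpha> = 0"
    by (auto simp: algebra_simps)
  then show ?thesis using root_nonzero[OF assms(1,2)] by auto
qed

text \<open>Equality in Cauchy-Schwarz would make \<beta> a multiple of \<alpha>, and the only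
  multiples of \<alpha> among the roots are \<alpha> and its negative.\<close>

lemma roots_strict_Cauchy_Schwarz:
  assumes "root_system \<Phi>" "\<alpha> \<in> \<Phi>" "\<beta> \<in> \<Phi>" "\<alpha> \<noteq> \<beta>" "\<alpha> \<noteq> - \<beta>"
  shows "(\<alpha> \<bullet> \<beta>)\<^sup>2 < (\<alpha> \<bullet> \<alpha>) * (\<beta> \<bullet> \<beta>)"
proof -
  have pos: "\<alpha> \<bullet> \<alpha> > 0" using root_nonzero assms(1,2) by auto
  \<comment> \<open>\<open>v\<close> is \<open>\<alpha> \<bullet> \<alpha>\<close> times the
    component of \<beta> orthogonal to \<alpha>.\<close>
  define v where "v = (\<alpha> \<bullet> \<alpha>) *\<^sub>R \<beta> - (\<alpha> \<bullet> \<beta>) *\<^sub>R \<alpha>"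
  have "v \<noteq> 0"
  proof
    assume "v = 0"
    then have "(1 / (\<alpha> \<bullet> \<alpha>)) *\<^sub>R ((\<alpha> \<bullet> \<alpha>) *\<^sub>R \<beta>) = (1 / (\<alpha> \<bullet> \<alpha>)) *\<^sub>R ((\<alpha> \<bullet> \<beta>) *\<^sub>R \<alpha>)"
      by (simp add: v_def)
    then have eq: "\<beta> = (\<alpha> \<bullet> \<beta> / (\<alpha> \<bullet> \<alpha>)) *\<^sub>R \<alpha>"
      using pos by simp
    then have "\<alpha> \<bullet> \<beta> / (\<alpha> \<bullet> \<alpha>) = 1 \<or> \<alpha> \<bullet> \<beta> / (\<alpha> \<bullet> \<alpha>) = -1"
      using root_multiple assms(1-3) by metis
    then show False using eq assms(4,5) by (metis minus_minus scaleR_minus1_left scaleR_one)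
  qed
  then have "0 < v \<bullet> v" by simp
  also have "v \<bullet> v = (\<alpha> \<bullet> \<alpha>) * ((\<alpha> \<bullet> \<alpha>) * (\<beta> \<bullet> \<beta>) - (\<alpha> \<bullet> \<beta>)\<^sup>2)"
    by (simp add: v_def inner_diff_left inner_diff_right inner_commute power2_eq_square algebra_simps)
  finally show ?thesis using pos by (simp add: zero_less_mult_iff)
qed

text \<open>The two Cartan integers \<open>k\<close> and \<open>l\<close> are positive, and their
  product is below 4 by strict Cauchy-Schwarz, so one of them is 1. The reflection belonging to it
  sends the other root to the difference, up to sign.\<close>

lemma roots_diff:
  assumes R: "root_system \<Phi>" and C: "crystallographic \<Phi>"
    and "\<alpha> \<in> \<Phi>" "\<beta> \<in> \<Phi>" "\<alpha> \<noteq> \<beta>" "\<alpha> \<bullet> \<beta> > 0"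
  shows "\<alpha> - \<beta> \<in> \<Phi>"
proof -
  have pos: "\<alpha> \<bullet> \<alpha> > 0" "\<beta> \<bullet> \<beta> > 0" using root_nonzero R assms(3,4) by auto
  have "\<alpha> \<noteq> - \<beta>"
    using assms(6) pos(2) by (metis inner_minus_left neg_0_less_iff_less order_less_asym)
  then have cs: "(\<alpha> \<bullet> \<beta>)\<^sup>2 < (\<alpha> \<bullet> \<alpha>) * (\<beta> \<bullet> \<beta>)"
    using roots_strict_Cauchy_Schwarz assms by blast
  obtain k :: int where k: "2 * (\<alpha> \<bullet> \<beta>) / (\<alpha> \<bullet> \<alpha>) = k"
    using C assms(3,4) unfolding crystallographic_def by (meson Ints_cases)
  obtain l :: int where l: "2 * (\<beta> \<bullet> \<alpha>) / (\<beta> \<bullet> \<beta>) = l"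
    using C assms(3,4) unfolding crystallographic_def by (meson Ints_cases)
  have "0 < real_of_int k" "0 < real_of_int l"
    unfolding k[symmetric] l[symmetric] using pos assms(6) by (auto simp: inner_commute)
  then have kl: "k \<ge> 1" "l \<ge> 1" by auto
  have "real_of_int (k * l) = 4 * (\<alpha> \<bullet> \<beta>)\<^sup>2 / ((\<alpha> \<bullet> \<alpha>) * (\<beta> \<bullet> \<beta>))"
    by (simp add: k[symmetric] l[symmetric] inner_commute power2_eq_square)
  also have "\<dots> < 4" using cs pos by (simp add: divide_less_eq)
  finally have "k * l < 4" by linarith
  moreover have "k * l \<ge> 2 * 2" if "k \<ge> 2" "l \<ge> 2" using that by (intro mult_mono) auto
  ultimately have "k = 1 \<or> l = 1" using kl by linarith
  then show ?thesis
  proof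
    assume "k = 1"
    then have "reflection \<alpha> \<beta> = - (\<alpha> - \<beta>)" unfolding reflection_def k by simp
    then have "- (\<alpha> - \<beta>) \<in> \<Phi>"
      using reflection_image_roots[OF R] assms(3,4) by (metis imageI)
    then show ?thesis using root_uminus[OF R] by fastforce
  next
    assume "l = 1"
    then have "reflection \<beta> \<alpha> = \<alpha> - \<beta>" unfolding reflection_def l by simp
    then show ?thesis using reflection_image_roots[OF R] assms(3,4) by (metis imageI)
  qed
qed

section \<open>Positive and simple systems\<close>

lemma positive_systemE:
  assumes "positive_system \<Phi> P"
  obtains c where "P = {\<gamma> \<in> \<Phi>. c \<bullet> \<gamma> > 0}" "\<And>\<gamma>. \<gamma> \<in> \<Phi> \<Longrightarrow> c \<bullet> \<gamma> \<noteq> 0"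
  using assms unfolding positive_system_def by blast

lemma positive_system_cases:
  assumes "root_system \<Phi>" "positive_system \<Phi> P" "\<gamma> \<in> \<Phi>"
  shows "\<gamma> \<in> P \<or> - \<gamma> \<in> P"
proof -
  obtain c where c: "P = {\<gamma> \<in> \<Phi>. c \<bullet> \<gamma> > 0}" "\<And>\<gamma>. \<gamma> \<in> \<Phi> \<Longrightarrow> c \<bullet> \<gamma> \<noteq> 0"
    using positive_systemE[OF assms(2)] by metis
  show ?thesis using c(2)[OF assms(3)] assms(3) root_uminus[OF assms(1,3)] by (auto simp: c(1))
qed

lemma simple_system_linear_image:
  assumes "simple_system P \<Delta>" "linear f" "inj f"
  shows "simple_system (f ` P) (f ` \<Delta>)"
  unfolding simple_system_def
proof (intro conjI allI impI)
  show "f ` \<Delta> \<subseteq> f ` P" using assms(1) unfolding simple_system_def by blast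
  show "convex_cone hull (f ` \<Delta>) = convex_cone hull (f ` P)"
    using assms(1) by (simp add: simple_system_def convex_cone_hull_linear_image[OF assms(2)])
  fix S assume "S \<subset> f ` \<Delta>"
  then obtain T where T: "T \<subset> \<Delta>" "S = f ` T"
    by (metis image_mono psubset_eq subset_image_iff)
  then have "convex_cone hull T \<noteq> convex_cone hull P"
    using assms(1) by (simp add: simple_system_def)
  then show "convex_cone hull S \<noteq> convex_cone hull (f ` P)"
    by (simp add: T(2) convex_cone_hull_linear_image[OF assms(2)] inj_image_eq_iff[OF assms(3)])
qed

text \<open>A generating set of the cone cannot avoid an extremal root. This recognises members of a
  simple system that is known only through its defining property.\<close>

lemma extremal_in_simple_system:
  assumes "simple_system P \<Delta>" "\<gamma> \<in> P" "\<gamma> \<notin> convex_cone hull (P - {\<gamma>})"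
  shows "\<gamma> \<in> \<Delta>"
proof (rule ccontr)
  assume "\<gamma> \<notin> \<Delta>"
  then have "\<Delta> \<subseteq> P - {\<gamma>}" using assms(1) unfolding simple_system_def by blast
  then have "convex_cone hull P \<subseteq> convex_cone hull (P - {\<gamma>})"
    using assms(1) hull_mono unfolding simple_system_def by metis
  then show False using assms(2,3) hull_inc by fastforce
qed

text \<open>The sums of the stated form already make up a convex cone containing \<delta> and
  \<open>S\<close>. The lemma isolates the coefficient of one generator.\<close>

lemma convex_cone_hull_insert_cases:
  assumes "z \<in> convex_cone hull (insert \<delta> S)"
  obtains t r where "t \<ge> 0" "r \<in> convex_cone hull S" "z = t *\<^sub>R \<delta> + r"
proof -
  let ?K = "{t *\<^sub>R \<delta> + r | t r. t \<ge> 0 \<and> r \<in> convex_cone hull S}"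
  have "convex_cone hull (insert \<delta> S) \<subseteq> ?K"
  proof (rule hull_minimal)
    have "\<delta> = 1 *\<^sub>R \<delta> + 0" by simp
    then have "\<delta> \<in> ?K" using convex_cone_hull_contains_0 by (smt (verit) mem_Collect_eq)
    moreover have "s \<in> ?K" if "s \<in> S" for s
    proof -
      have "s = 0 *\<^sub>R \<delta> + s" by simp
      then show ?thesis using hull_inc[OF that] by (smt (verit) mem_Collect_eq)
    qed
    ultimately show "insert \<delta> S \<subseteq> ?K" by blast
    show "convex_cone ?K"
    proof (intro convex_cone_iff[THEN iffD2] conjI ballI allI impI)
      have "0 = 0 *\<^sub>R \<delta> + 0" by simp
      then show "0 \<in> ?K" using convex_cone_hull_contains_0 by (smt (verit) mem_Collect_eq)
    next
      fix x y assume "x \<in> ?K" "y \<in> ?K"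
      then obtain t r t' r' where "t \<ge> 0" "r \<in> convex_cone hull S" "x = t *\<^sub>R \<delta> + r"
        "t' \<ge> 0" "r' \<in> convex_cone hull S" "y = t' *\<^sub>R \<delta> + r'" by blast
      moreover from this have "x + y = (t + t') *\<^sub>R \<delta> + (r + r')" by (simp add: algebra_simps)
      ultimately show "x + y \<in> ?K" using convex_cone_hull_add by fastforce
    next
      fix x :: 'a and k :: real assume "x \<in> ?K" "k \<ge> 0"
      then obtain t r where "t \<ge> 0" "r \<in> convex_cone hull S" "x = t *\<^sub>R \<delta> + r" by blast
      moreover from this have "k *\<^sub>R x = (k * t) *\<^sub>R \<delta> + k *\<^sub>R r" by (simp add: algebra_simps)
      ultimately show "k *\<^sub>R x \<in> ?K" using convex_cone_hull_mul \<open>k \<ge> 0\<close> by fastforce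
    qed
  qed
  then show ?thesis using assms that by blast
qed

text \<open>Otherwise write \<beta> as \<open>t *\<^sub>R ?g + r\<close> with \<open>r\<close> in
  the cone of the other simple roots. Then \<open>(1 - t) *\<^sub>R ?g = \<alpha> + r\<close>, and
  evaluating the positive functional \<open>c\<close> gives \<open>t < 1\<close>. So
  \<open>?g\<close> lies in the cone of the others, against minimality.\<close>

lemma simple_root_not_sum:
  assumes R: "root_system \<Phi>" and P: "positive_system \<Phi> P" and S: "simple_system P \<Delta>"
    and "\<alpha> \<in> \<Delta>" "\<beta> \<in> P"
  shows "\<alpha> + \<beta> \<notin> \<Delta>"
proof
  let ?g = "\<alpha> + \<beta>"
  let ?C = "convex_cone hull (\<Delta> - {?g})"
  assume g: "?g \<in> \<Delta>"
  obtain c where c: "P = {\<gamma> \<in> \<Phi>. c \<bullet> \<gamma> > 0}" using positive_systemE[OF P] by metis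
  have sub: "\<Delta> \<subseteq> P" and eq: "convex_cone hull \<Delta> = convex_cone hull P"
    using S unfolding simple_system_def by auto
  have "\<beta> \<in> convex_cone hull (insert ?g (\<Delta> - {?g}))"
    using hull_inc[OF assms(5)] eq g by (simp add: insert_absorb)
  then obtain t r where tr: "t \<ge> 0" "r \<in> ?C" "\<beta> = t *\<^sub>R ?g + r"
    using convex_cone_hull_insert_cases by blast
  \<comment> \<open>Hence \<alpha> differs from \<open>?g\<close> and is still among the remaining
    generators.\<close>
  have "\<beta> \<noteq> 0" using assms(5) c by auto
  then have "\<alpha> \<in> ?C" using assms(4) by (intro hull_inc) auto
  then have ar: "\<alpha> + r \<in> ?C" using tr(2) convex_cone_hull_add by blast
  have "?g = (\<alpha> + r) + t *\<^sub>R ?g" using tr(3) by (simp add: algebra_simps)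
  then have rel: "(1 - t) *\<^sub>R ?g = \<alpha> + r" by (simp only: scaleR_diff_left scaleR_one) (metis add_diff_cancel_right')
  have "?C \<subseteq> {x. c \<bullet> x \<ge> 0}"
    using sub c by (intro hull_minimal convex_cone_halfspace_ge) auto
  then have "c \<bullet> r \<ge> 0" using tr(2) by blast
  moreover have "c \<bullet> \<alpha> > 0" "c \<bullet> ?g > 0" using sub c assms(4) g by auto
  moreover have "(1 - t) * (c \<bullet> ?g) = c \<bullet> \<alpha> + c \<bullet> r"
    using rel by (metis inner_add_right inner_scaleR_right)
  ultimately have "(1 - t) * (c \<bullet> ?g) > 0" by linarith
  then have t1: "1 - t > 0" using \<open>c \<bullet> ?g > 0\<close> by (simp add: zero_less_mult_iff)
  have "?g = (1 / (1 - t)) *\<^sub>R (\<alpha> + r)" using t1 unfolding rel[symmetric] by simp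
  also have "\<dots> \<in> ?C" using t1 by (intro convex_cone_hull_mul[OF ar]) simp
  finally have gC: "?g \<in> ?C" .
  have "\<delta> \<in> ?C" if "\<delta> \<in> \<Delta>" for \<delta>
    using gC hull_inc[of \<delta> "\<Delta> - {?g}"] that by blast
  then have "convex_cone hull \<Delta> \<subseteq> ?C" by (intro hull_minimal convex_cone_convex_cone_hull) blast
  moreover have "?C \<subseteq> convex_cone hull \<Delta>" by (intro hull_mono) blast
  ultimately have "?C = convex_cone hull P" using eq by blast
  moreover have "\<Delta> - {?g} \<subset> \<Delta>" using g by blast
  ultimately show False using S unfolding simple_system_def by blast
qed

text \<open>With a positive inner product the difference would be a root. It or its negative is
  positive, which exhibits one of the two simple roots as the other plus a positive root.\<close>

lemma simple_roots_obtuse: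
  assumes R: "root_system \<Phi>" and C: "crystallographic \<Phi>"
    and P: "positive_system \<Phi> P" and S: "simple_system P \<Delta>"
    and "\<alpha> \<in> \<Delta>" "\<beta> \<in> \<Delta>" "\<alpha> \<noteq> \<beta>"
  shows "\<alpha> \<bullet> \<beta> \<le> 0"
proof (rule ccontr)
  assume "\<not> \<alpha> \<bullet> \<beta> \<le> 0"
  moreover have "\<alpha> \<in> \<Phi>" "\<beta> \<in> \<Phi>"
    using S P assms(5,6) unfolding simple_system_def positive_system_def by auto
  ultimately have "\<alpha> - \<beta> \<in> \<Phi>" using roots_diff[OF R C] assms(7) by simp
  then consider "\<alpha> - \<beta> \<in> P" | "\<beta> - \<alpha> \<in> P" using positive_system_cases[OF R P] by force
  then show False
    using simple_root_not_sum[OF R P S assms(5), of "\<beta> - \<alpha>"]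
      simple_root_not_sum[OF R P S assms(6), of "\<alpha> - \<beta>"] assms(5,6)
    by cases auto
qed

section \<open>The Weyl group acts transitively on positive systems\<close>

lemma weyl_group_compose:
  assumes "v \<in> carrier (BijGroup UNIV)" "w \<in> carrier (BijGroup UNIV)"
  shows "v \<otimes>\<^bsub>BijGroup UNIV\<^esub> w = v \<circ> w"
  using assms by (auto simp: BijGroup_def compose_def fun_eq_iff)

lemma reflection_inv:
  "inv\<^bsub>BijGroup UNIV\<^esub> (reflection \<alpha>) = reflection \<alpha>"
proof (rule group.inv_equality[OF group_BijGroup])
  show "reflection \<alpha> \<otimes>\<^bsub>BijGroup UNIV\<^esub> reflection \<alpha> = \<one>\<^bsub>BijGroup UNIV\<^esub>"
    unfolding weyl_group_compose[OF reflection_in_carrier_BijGroup reflection_in_carrier_BijGroup]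
    by (auto simp: BijGroup_def fun_eq_iff reflection_reflection)
qed (rule reflection_in_carrier_BijGroup)+

lemma weyl_group_properties:
  assumes R: "root_system \<Phi>" and w: "w \<in> weyl_group \<Phi>"
  shows "w \<in> carrier (BijGroup UNIV)" "linear w" "w ` \<Phi> = \<Phi>"
proof -
  have "w \<in> carrier (BijGroup UNIV) \<and> linear w \<and> w ` \<Phi> = \<Phi>"
    using w unfolding weyl_group_def
  proof induction
    case one
    have eq: "\<one>\<^bsub>BijGroup UNIV\<^esub> = (\<lambda>x::'a. x)" by (simp add: BijGroup_def fun_eq_iff)
    have "\<one>\<^bsub>BijGroup UNIV\<^esub> \<in> carrier (BijGroup (UNIV :: 'a set))"
      by (rule monoid.one_closed[OF group.is_monoid[OF group_BijGroup]])
    then show ?case using linear_ident unfolding eq by simp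
  next
    case (incl h)
    then obtain \<alpha> where "\<alpha> \<in> \<Phi>" "h = reflection \<alpha>" by blast
    then show ?case
      using linear_reflection[of \<alpha>] reflection_image_roots[OF R, of \<alpha>]
        reflection_in_carrier_BijGroup[of \<alpha>] by simp
  next
    case (inv h)
    then obtain \<alpha> where "\<alpha> \<in> \<Phi>" "h = reflection \<alpha>" by blast
    then show ?case
      using linear_reflection[of \<alpha>] reflection_image_roots[OF R, of \<alpha>]
        reflection_in_carrier_BijGroup[of \<alpha>] by (simp add: reflection_inv)
  next
    case (eng v w)
    then have "v \<otimes>\<^bsub>BijGroup UNIV\<^esub> w \<in> carrier (BijGroup UNIV)"
      using monoid.m_closed[OF group.is_monoid[OF group_BijGroup]] by blast
    moreover have "v \<otimes>\<^bsub>BijGroup UNIV\<^esub> w = v \<circ> w" using eng weyl_group_compose by blast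
    moreover have "linear (v \<circ> w)" using eng linear_compose by blast
    moreover have "(v \<circ> w) ` \<Phi> = \<Phi>" using eng by (metis image_comp)
    ultimately show ?case by metis
  qed
  then show "w \<in> carrier (BijGroup UNIV)" "linear w" "w ` \<Phi> = \<Phi>" by auto
qed

lemma weyl_group_comp_reflection:
  assumes "root_system \<Phi>" "w \<in> weyl_group \<Phi>" "\<alpha> \<in> \<Phi>"
  shows "w \<circ> reflection \<alpha> \<in> weyl_group \<Phi>"
proof -
  have "w \<otimes>\<^bsub>BijGroup UNIV\<^esub> reflection \<alpha> \<in> weyl_group \<Phi>"
    using generate.eng[OF assms(2)[unfolded weyl_group_def] generate.incl] assms(3)
    unfolding weyl_group_def by blast
  then show ?thesis
    using weyl_group_compose[OF weyl_group_properties(1)[OF assms(1,2)] reflection_in_carrier_BijGroup]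
    by simp
qed

text \<open>On the span of the roots, \<open>w\<close> is determined by the map that it induces from
  \<Phi> to itself, and there are finitely many such maps.\<close>

lemma finite_weyl_orbit:
  assumes R: "root_system \<Phi>" and "x \<in> span \<Phi>"
  shows "finite ((\<lambda>w. w x) ` weyl_group \<Phi>)"
proof -
  have fin: "finite \<Phi>" using R unfolding root_system_def by blast
  obtain a where a: "x = (\<Sum>\<phi>\<in>\<Phi>. a \<phi> *\<^sub>R \<phi>)" using assms(2) span_finite[OF fin] by auto
  have "(\<lambda>w. w x) ` weyl_group \<Phi> \<subseteq> (\<lambda>f. \<Sum>\<phi>\<in>\<Phi>. a \<phi> *\<^sub>R f \<phi>) ` (\<Phi> \<rightarrow>\<^sub>E \<Phi>)"
  proof clarify
    fix w assume w: "w \<in> weyl_group \<Phi>"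
    note props = weyl_group_properties[OF R w]
    have "w x = (\<Sum>\<phi>\<in>\<Phi>. a \<phi> *\<^sub>R restrict w \<Phi> \<phi>)"
      by (simp add: a linear_sum[OF props(2)] linear_scale[OF props(2)])
    moreover have "restrict w \<Phi> \<in> \<Phi> \<rightarrow>\<^sub>E \<Phi>" using props(3) by auto
    ultimately show "w x \<in> (\<lambda>f. \<Sum>\<phi>\<in>\<Phi>. a \<phi> *\<^sub>R f \<phi>) ` (\<Phi> \<rightarrow>\<^sub>E \<Phi>)" by blast
  qed
  moreover have "finite (\<Phi> \<rightarrow>\<^sub>E \<Phi>)" using fin by (intro finite_PiE) auto
  ultimately show ?thesis by (meson finite_imageI finite_subset)
qed

text \<open>Choose \<open>w\<close> maximizing \<open>h \<bullet> w y\<close> over a finite orbit.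
  For \<gamma> in \<open>P\<close>, passing to \<open>w \<circ> reflection \<gamma>\<close>
  subtracts a positive multiple of \<open>w \<gamma>\<close> from \<open>w y\<close>, so maximality
  makes \<open>h\<close> nonnegative, and hence positive, on \<open>w \<gamma>\<close>.\<close>

lemma weyl_group_transitive_on_positive_systems:
  fixes \<Phi> :: "'a::euclidean_space set"
  assumes R: "root_system \<Phi>" and P: "positive_system \<Phi> P" and Q: "positive_system \<Phi> Q"
  obtains w where "w \<in> weyl_group \<Phi>" "w ` P = Q"
proof -
  obtain c where c: "P = {\<gamma> \<in> \<Phi>. c \<bullet> \<gamma> > 0}" using positive_systemE[OF P] by metis
  obtain h where h: "Q = {\<gamma> \<in> \<Phi>. h \<bullet> \<gamma> > 0}" "\<And>\<gamma>. \<gamma> \<in> \<Phi> \<Longrightarrow> h \<bullet> \<gamma> \<noteq> 0"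
    using positive_systemE[OF Q] by metis
  \<comment> \<open>\<open>c\<close> is replaced by its projection to the span of the roots, whose orbit is finite.\<close>
  obtain y z where yz: "y \<in> span \<Phi>" "\<And>u. u \<in> span \<Phi> \<Longrightarrow> orthogonal z u" "c = y + z"
    using orthogonal_subspace_decomp_exists[of \<Phi> c] by metis
  have y: "y \<bullet> \<gamma> = c \<bullet> \<gamma>" if "\<gamma> \<in> \<Phi>" for \<gamma>
    using yz(2)[OF span_base[OF that]] by (simp add: yz(3) inner_add_left orthogonal_def)
  let ?A = "(\<lambda>w. h \<bullet> w y) ` weyl_group \<Phi>"
  have "?A = (\<lambda>x. h \<bullet> x) ` (\<lambda>w. w y) ` weyl_group \<Phi>" by (simp add: image_image)
  then have "finite ?A" using finite_weyl_orbit[OF R yz(1)] by simp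
  moreover have "?A \<noteq> {}" unfolding weyl_group_def using generate.one by blast
  ultimately have "Max ?A \<in> ?A" "\<And>a. a \<in> ?A \<Longrightarrow> a \<le> Max ?A" by auto
  then obtain w where w: "w \<in> weyl_group \<Phi>" "\<And>v. v \<in> weyl_group \<Phi> \<Longrightarrow> h \<bullet> v y \<le> h \<bullet> w y"
    by auto
  note props = weyl_group_properties[OF R w(1)]
  have sub: "w \<gamma> \<in> Q" if "\<gamma> \<in> P" for \<gamma>
  proof -
    have g: "\<gamma> \<in> \<Phi>" "c \<bullet> \<gamma> > 0" using that c by auto
    have gg: "\<gamma> \<bullet> \<gamma> > 0" using root_nonzero[OF R g(1)] by simp
    have "h \<bullet> w (reflection \<gamma> y) \<le> h \<bullet> w y"
      using w(2)[OF weyl_group_comp_reflection[OF R w(1) g(1)]] by simp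
    moreover have "w (reflection \<gamma> y) = w y - (2 * (c \<bullet> \<gamma>) / (\<gamma> \<bullet> \<gamma>)) *\<^sub>R w \<gamma>"
      using y[OF g(1)]
      by (simp add: reflection_def linear_diff[OF props(2)] linear_scale[OF props(2)] inner_commute)
    ultimately have "(2 * (c \<bullet> \<gamma>) / (\<gamma> \<bullet> \<gamma>)) * (h \<bullet> w \<gamma>) \<ge> 0"
      by (simp add: inner_diff_right)
    moreover have "2 * (c \<bullet> \<gamma>) / (\<gamma> \<bullet> \<gamma>) > 0" using g gg by simp
    ultimately have "h \<bullet> w \<gamma> \<ge> 0" by (meson mult_pos_neg not_le)
    moreover have "w \<gamma> \<in> \<Phi>" using props(3) g(1) by blast
    ultimately show ?thesis using h by (force simp: less_le)
  qed
  have "w ` P = Q"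
  proof
    show "w ` P \<subseteq> Q" using sub by blast
    show "Q \<subseteq> w ` P"
    proof
      fix q assume q: "q \<in> Q"
      then obtain \<phi> where f: "\<phi> \<in> \<Phi>" "q = w \<phi>" using props(3) h(1) by blast
      \<comment> \<open>The inclusion just shown is an equality, because exactly one of each pair of
        opposite roots is positive in either system.\<close>
      have "- \<phi> \<notin> P"
      proof
        assume "- \<phi> \<in> P"
        then have "- q \<in> Q" using sub f(2) linear_neg[OF props(2)] by metis
        then show False using q h(1) by auto
      qed
      then show "q \<in> w ` P" using positive_system_cases[OF R P f(1)] f(2) by blast
    qed
  qed
  then show ?thesis using w(1) that by blast
qed

section \<open>Incomparable roots\<close>

text \<open>A positive inner product would make the difference a root, so it or its negative would
  lie in \<open>P\<close> and make the two roots comparable.\<close>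

lemma incomparable_roots_obtuse:
  assumes R: "root_system \<Phi>" and C: "crystallographic \<Phi>" and P: "positive_system \<Phi> P"
    and "\<alpha> \<in> P" "\<beta> \<in> P" and I: "incomparable_roots P \<alpha> \<beta>"
  shows "\<alpha> \<noteq> \<beta>" "\<alpha> \<bullet> \<beta> \<le> 0"
proof -
  show ne: "\<alpha> \<noteq> \<beta>"
    using I by (auto simp: incomparable_roots_def root_le_def convex_cone_hull_contains_0)
  have mem: "\<alpha> \<in> \<Phi>" "\<beta> \<in> \<Phi>" using P assms(4,5) unfolding positive_system_def by auto
  show "\<alpha> \<bullet> \<beta> \<le> 0"
  proof (rule ccontr)
    assume "\<not> \<alpha> \<bullet> \<beta> \<le> 0"
    then have "\<alpha> - \<beta> \<in> \<Phi>" using roots_diff[OF R C mem ne] by simp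
    then consider "\<alpha> - \<beta> \<in> P" | "\<beta> - \<alpha> \<in> P" using positive_system_cases[OF R P] by force
    then show False using I hull_inc unfolding incomparable_roots_def root_le_def by metis
  qed
qed

section \<open>The rank-two system spanned by two incomparable roots\<close>

lemma positive_roots_strict_Cauchy_Schwarz:
  assumes R: "root_system \<Phi>" and P: "positive_system \<Phi> P" and "\<alpha> \<in> P" "\<beta> \<in> P" "\<alpha> \<noteq> \<beta>"
  shows "(\<alpha> \<bullet> \<beta>)\<^sup>2 < (\<alpha> \<bullet> \<alpha>) * (\<beta> \<bullet> \<beta>)"
proof -
  obtain c where c: "P = {\<gamma> \<in> \<Phi>. c \<bullet> \<gamma> > 0}" using positive_systemE[OF P] by metis
  have "\<alpha> \<noteq> - \<beta>" using assms(3,4) c by auto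
  then show ?thesis using roots_strict_Cauchy_Schwarz[OF R] assms(3-5) c by blast
qed

text \<open>The first assumption says that the Gram determinant is positive; pairing the relation
  with \<alpha> and \<beta> gives a regular linear system for \<open>p\<close> and
  \<open>q\<close>.\<close>

lemma strict_Cauchy_Schwarz_independent:
  assumes "(\<alpha> \<bullet> \<beta>)\<^sup>2 < (\<alpha> \<bullet> \<alpha>) * (\<beta> \<bullet> \<beta>)" "p *\<^sub>R \<alpha> + q *\<^sub>R \<beta> = 0"
  shows "p = 0" "q = 0"
proof -
  have "(p *\<^sub>R \<alpha> + q *\<^sub>R \<beta>) \<bullet> \<alpha> = 0" "(p *\<^sub>R \<alpha> + q *\<^sub>R \<beta>) \<bullet> \<beta> = 0" using assms(2) by auto
  then have 1: "p * (\<alpha> \<bullet> \<alpha>) + q * (\<alpha> \<bullet> \<beta>) = 0" and 2: "p * (\<alpha> \<bullet> \<beta>) + q * (\<beta> \<bullet> \<beta>) = 0"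
    by (simp_all add: inner_add_left inner_add_right inner_commute)
  have "p * ((\<alpha> \<bullet> \<alpha>) * (\<beta> \<bullet> \<beta>) - (\<alpha> \<bullet> \<beta>)\<^sup>2) = 0" "q * ((\<alpha> \<bullet> \<alpha>) * (\<beta> \<bullet> \<beta>) - (\<alpha> \<bullet> \<beta>)\<^sup>2) = 0"
    using 1 2 by algebra+
  then show "p = 0" "q = 0" using assms(1) by auto
qed

text \<open>The coefficients \<open>u, v\<close> are those of a root \<open>u \<alpha> - v \<beta>\<close>, and \<open>- K, - L\<close> are the Cartan integers
  of \<open>\<alpha>\<close> and \<open>\<beta>\<close>; the disjunction covers all Cartan matrices of rank two.\<close>

lemma rank_two_coefficients:
  fixes u v :: real and K L M N :: int
  assumes uv: "0 < u" "u \<le> 1" "0 < v" "v \<le> 1"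
    and KL: "K \<ge> 0" "L \<ge> 0" "K = 0 \<longleftrightarrow> L = 0" "K * L < 4"
    and M: "2 * u + v * K = M" and N: "u * L + 2 * v = N"
  shows "u = v \<or> u = 1 \<or> v = 1"
proof -
  have mono: "i * j \<le> K * L" if "i \<le> K" "j \<le> L" "0 \<le> j" for i j
    using that KL(1) by (intro mult_mono) auto
  have "K = 0 \<and> L = 0 \<or> K = 1 \<and> L = 1 \<or> K = 1 \<and> L = 2 \<or> K = 2 \<and> L = 1 \<or>
      K = 1 \<and> L = 3 \<or> K = 3 \<and> L = 1"
  proof (cases "K = 0")
    case False
    then have "K \<ge> 1" "L \<ge> 1" using KL(1-3) by auto
    then have "\<not> K \<ge> 4" "\<not> L \<ge> 4" "\<not> (K \<ge> 2 \<and> L \<ge> 2)"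
      using mono[of 4 1] mono[of 1 4] mono[of 2 2] KL(4) by auto
    then have "K = 1 \<or> K = 2 \<or> K = 3" "L = 1 \<or> L = 2 \<or> L = 3"
      using \<open>K \<ge> 1\<close> \<open>L \<ge> 1\<close> by auto
    then show ?thesis using \<open>\<not> (K \<ge> 2 \<and> L \<ge> 2)\<close> by auto
  qed (use KL(3) in blast)
  \<comment> \<open>In cases 3 to 6 an integral combination of the equations for \<open>M\<close>
    and \<open>N\<close> isolates \<open>u\<close> or \<open>v\<close>, which is then an integer in
    (0,1].\<close>
  moreover have ints: "t = 1" if "t = real_of_int k" "0 < t" "t \<le> 1" for t k
  proof -
    have "k = 1" using that by linarith
    then show ?thesis using that by simp
  qed
  ultimately consider "K = 0" "L = 0" | "K = 1" "L = 1" | "K = 1" "L = 2" | "K = 2" "L = 1"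
    | "K = 1" "L = 3" | "K = 3" "L = 1" by blast
  then show ?thesis
  proof cases
    \<comment> \<open>In the first two cases, types A1 x A1 and A2, the bounds leave finitely many
      pairs \<open>M\<close>, \<open>N\<close> to check.\<close>
    case 1
    then have "2 * u = M" "2 * v = N" using M N by simp_all
    moreover from this have "M = 1 \<or> M = 2" "N = 1 \<or> N = 2" using uv by linarith+
    ultimately show ?thesis by auto
  next
    case 2
    then have eqs: "2 * u + v = M" "u + 2 * v = N" using M N by simp_all
    then have "M = 1 \<or> M = 2 \<or> M = 3" "N = 1 \<or> N = 2 \<or> N = 3" using uv by linarith+
    then show ?thesis using eqs uv by auto
  next
    case 3
    then have "v = real_of_int (N - M)" using M N by simp
    then show ?thesis using ints uv by blast
  next
    case 4
    then have "u = real_of_int (M - N)" using M N by simp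
    then show ?thesis using ints uv by blast
  next
    case 5
    then have "u = real_of_int (2 * M - N)" using M N by simp
    then show ?thesis using ints uv by blast
  next
    case 6
    then have "v = real_of_int (2 * N - M)" using M N by simp
    then show ?thesis using ints uv by blast
  qed
qed

text \<open>A root in the span of \<alpha> and \<beta> cannot have coefficients of opposite signs. A
  counterexample that is minimal for \<open>g\<close> has both \<open>u\<close> and \<open>v\<close>
  at most 1, since otherwise subtracting \<alpha> or adding \<beta> gives a smaller one. Integrality
  then forces \<open>u = v\<close>, so \<open>\<alpha> - \<beta>\<close> is a positive multiple of a
  root and \<alpha>, \<beta> are comparable.\<close>

lemma incomparable_roots_simple_in_rank_two:
  assumes R: "root_system \<Phi>" and C: "crystallographic \<Phi>" and P: "positive_system \<Phi> P"
    and "\<alpha> \<in> P" "\<beta> \<in> P" and I: "incomparable_roots P \<alpha> \<beta>" and "u > 0" "v > 0"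
  shows "u *\<^sub>R \<alpha> - v *\<^sub>R \<beta> \<notin> \<Phi>"
proof
  assume uv0: "u *\<^sub>R \<alpha> - v *\<^sub>R \<beta> \<in> \<Phi>"
  have mem: "\<alpha> \<in> \<Phi>" "\<beta> \<in> \<Phi>" using P assms(4,5) unfolding positive_system_def by auto
  have pos: "\<alpha> \<bullet> \<alpha> > 0" "\<beta> \<bullet> \<beta> > 0" using root_nonzero[OF R] mem by auto
  note ne = incomparable_roots_obtuse(1)[OF R C P assms(4-6)]
  note ob = incomparable_roots_obtuse(2)[OF R C P assms(4-6)]
  note CS = positive_roots_strict_Cauchy_Schwarz[OF R P assms(4,5) ne]
  note ind = strict_Cauchy_Schwarz_independent[OF CS]
  define S where "S = {\<gamma> \<in> \<Phi>. \<exists>u v. u > 0 \<and> v > 0 \<and> \<gamma> = u *\<^sub>R \<alpha> - v *\<^sub>R \<beta>}"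
  \<comment> \<open>\<open>g\<close> adds the pairings with the coroots of \<alpha> and of the
    negative of \<beta>. As \<open>\<alpha> \<bullet> \<beta> \<le> 0\<close>, subtracting \<alpha>
    or adding \<beta> lowers it by at least 2.\<close>
  define g where "g \<gamma> = 2 * (\<gamma> \<bullet> \<alpha>) / (\<alpha> \<bullet> \<alpha>) - 2 * (\<gamma> \<bullet> \<beta>) / (\<beta> \<bullet> \<beta>)" for \<gamma>
  have "finite (g ` S)" "g ` S \<noteq> {}" using R uv0 assms(7,8) unfolding S_def root_system_def by auto
  then have "Min (g ` S) \<in> g ` S" "\<And>a. a \<in> g ` S \<Longrightarrow> Min (g ` S) \<le> a" by auto
  then obtain \<gamma> where \<gamma>: "\<gamma> \<in> S" and min: "\<And>\<gamma>'. \<gamma>' \<in> S \<Longrightarrow> g \<gamma> \<le> g \<gamma>'"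
    by auto
  then obtain u v where uv: "u > 0" "v > 0" and \<gamma>eq: "\<gamma> = u *\<^sub>R \<alpha> - v *\<^sub>R \<beta>" and \<gamma>\<Phi>: "\<gamma> \<in> \<Phi>"
    unfolding S_def by blast
  have "u * (\<alpha> \<bullet> \<alpha>) > 0" "v * (\<beta> \<bullet> \<beta>) > 0" "v * (\<alpha> \<bullet> \<beta>) \<le> 0" "u * (\<alpha> \<bullet> \<beta>) \<le> 0"
    using uv pos ob by (simp_all add: mult_nonneg_nonpos)
  then have ga: "\<gamma> \<bullet> \<alpha> > 0" and gb: "\<gamma> \<bullet> (- \<beta>) > 0"
    by (simp_all add: \<gamma>eq inner_diff_left inner_diff_right inner_commute)
  have nea: "\<gamma> \<noteq> \<alpha>"
    using ind(2)[of "u - 1" "- v"] uv by (auto simp: \<gamma>eq algebra_simps)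
  have neb: "\<gamma> \<noteq> - \<beta>"
    using ind(1)[of u "1 - v"] uv by (auto simp: \<gamma>eq algebra_simps)
  have suba: "(u - 1) *\<^sub>R \<alpha> - v *\<^sub>R \<beta> \<in> \<Phi>"
    using roots_diff[OF R C \<gamma>\<Phi> mem(1) nea ga] by (simp add: \<gamma>eq algebra_simps)
  have subb: "u *\<^sub>R \<alpha> - (v - 1) *\<^sub>R \<beta> \<in> \<Phi>"
    using roots_diff[OF R C \<gamma>\<Phi> root_uminus[OF R mem(2)] neb gb] by (simp add: \<gamma>eq algebra_simps)
  have u1: "u \<le> 1"
  proof (rule ccontr)
    assume "\<not> u \<le> 1"
    then have "(u - 1) *\<^sub>R \<alpha> - v *\<^sub>R \<beta> \<in> S" unfolding S_def using suba uv(2)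
      by (smt (verit) mem_Collect_eq)
    moreover have "(u - 1) *\<^sub>R \<alpha> - v *\<^sub>R \<beta> = \<gamma> - \<alpha>" by (simp add: \<gamma>eq algebra_simps)
    ultimately have "g \<gamma> \<le> g (\<gamma> - \<alpha>)" using min by metis
    moreover have "g (\<gamma> - \<alpha>) = g \<gamma> - 2 + 2 * (\<alpha> \<bullet> \<beta>) / (\<beta> \<bullet> \<beta>)"
      using pos by (simp add: g_def inner_diff_left diff_divide_distrib right_diff_distrib)
    moreover have "2 * (\<alpha> \<bullet> \<beta>) / (\<beta> \<bullet> \<beta>) \<le> 0" using ob pos by (simp add: divide_le_0_iff)
    ultimately show False by linarith
  qed
  have v1: "v \<le> 1"
  proof (rule ccontr)
    assume "\<not> v \<le> 1"
    then have "u *\<^sub>R \<alpha> - (v - 1) *\<^sub>R \<beta> \<in> S" unfolding S_def using subb uv(1)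
      by (smt (verit) mem_Collect_eq)
    moreover have "u *\<^sub>R \<alpha> - (v - 1) *\<^sub>R \<beta> = \<gamma> + \<beta>" by (simp add: \<gamma>eq algebra_simps)
    ultimately have "g \<gamma> \<le> g (\<gamma> + \<beta>)" using min by metis
    moreover have "g (\<gamma> + \<beta>) = g \<gamma> - 2 + 2 * (\<alpha> \<bullet> \<beta>) / (\<alpha> \<bullet> \<alpha>)"
      using pos by (simp add: g_def inner_add_left add_divide_distrib distrib_left inner_commute[of \<beta> \<alpha>])
    moreover have "2 * (\<alpha> \<bullet> \<beta>) / (\<alpha> \<bullet> \<alpha>) \<le> 0" using ob pos by (simp add: divide_le_0_iff)
    ultimately show False by linarith
  qed
  have cint: "\<exists>k::int. 2 * (x \<bullet> y) / (x \<bullet> x) = k" if "x \<in> \<Phi>" "y \<in> \<Phi>" for x y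
    using C that unfolding crystallographic_def by (meson Ints_cases)
  obtain k l m n :: int where
    k: "2 * (\<alpha> \<bullet> \<beta>) / (\<alpha> \<bullet> \<alpha>) = k" and l: "2 * (\<beta> \<bullet> \<alpha>) / (\<beta> \<bullet> \<beta>) = l" and
    m: "2 * (\<alpha> \<bullet> \<gamma>) / (\<alpha> \<bullet> \<alpha>) = m" and n: "2 * (\<beta> \<bullet> \<gamma>) / (\<beta> \<bullet> \<beta>) = n"
    using cint mem \<gamma>\<Phi> by metis
  have "u = v \<or> u = 1 \<or> v = 1"
  proof (rule rank_two_coefficients[OF uv(1) u1 uv(2) v1])
    have "real_of_int k \<le> 0" "real_of_int l \<le> 0"
      unfolding k[symmetric] l[symmetric] using ob pos by (auto simp: divide_le_0_iff inner_commute)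
    then show "- k \<ge> 0" "- l \<ge> 0" by auto
    have "k = 0 \<longleftrightarrow> real_of_int k = 0" "l = 0 \<longleftrightarrow> real_of_int l = 0" by auto
    then show "- k = 0 \<longleftrightarrow> - l = 0"
      unfolding k[symmetric] l[symmetric] using pos by (auto simp: inner_commute)
    have "real_of_int (k * l) = 4 * (\<alpha> \<bullet> \<beta>)\<^sup>2 / ((\<alpha> \<bullet> \<alpha>) * (\<beta> \<bullet> \<beta>))"
      by (simp add: k[symmetric] l[symmetric] inner_commute power2_eq_square)
    also have "\<dots> < 4" using CS pos by (simp add: divide_less_eq)
    finally have "k * l < 4" by linarith
    then show "(- k) * (- l) < 4" by simp
    show "2 * u + v * real_of_int (- k) = real_of_int m"
      unfolding of_int_minus k[symmetric] m[symmetric] using pos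
      by (simp add: \<gamma>eq inner_diff_right field_simps)
    show "u * real_of_int (- l) + 2 * v = real_of_int (- n)"
      unfolding of_int_minus l[symmetric] n[symmetric] using pos
      by (simp add: \<gamma>eq inner_diff_right field_simps)
  qed
  \<comment> \<open>If one coefficient is 1, removing it leaves a root proportional to \<beta> or
    \<alpha>, so the other coefficient is 1 as well.\<close>
  moreover have "v = 1" if "u = 1"
  proof -
    have "(- v) *\<^sub>R \<beta> \<in> \<Phi>" using suba that by simp
    then show ?thesis using root_multiple[OF R mem(2)] uv(2) by fastforce
  qed
  moreover have "u = 1" if "v = 1"
  proof -
    have "u *\<^sub>R \<alpha> \<in> \<Phi>" using subb that by simp
    then show ?thesis using root_multiple[OF R mem(1)] uv(1) by fastforce
  qed
  ultimately have "u = v" by auto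
  then have eq: "\<alpha> - \<beta> = (1 / u) *\<^sub>R \<gamma>" "\<beta> - \<alpha> = (1 / u) *\<^sub>R (- \<gamma>)"
    using uv by (simp_all add: \<gamma>eq algebra_simps)
  have "\<gamma> \<in> convex_cone hull P \<or> - \<gamma> \<in> convex_cone hull P"
    using positive_system_cases[OF R P \<gamma>\<Phi>] hull_inc by metis
  then have "\<alpha> - \<beta> \<in> convex_cone hull P \<or> \<beta> - \<alpha> \<in> convex_cone hull P"
    unfolding eq using uv(1) convex_cone_hull_mul[of _ P "1 / u"]
    by (metis less_eq_real_def zero_less_divide_1_iff)
  then show False using I unfolding incomparable_roots_def root_le_def by blast
qed

section \<open>The positive system with prescribed positive simple roots\<close>

text \<open>A finite union of hyperplanes is negligible, while a nonempty open set is not.\<close>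

lemma open_avoiding_hyperplanes:
  fixes U V :: "'a::euclidean_space set"
  assumes "open U" "U \<noteq> {}" "finite V"
  obtains c where "c \<in> U" "\<And>v. v \<in> V \<Longrightarrow> v \<noteq> 0 \<Longrightarrow> c \<bullet> v \<noteq> 0"
proof -
  have "negligible (\<Union>v\<in>V - {0}. {x. v \<bullet> x = 0})"
    using assms(3) negligible_hyperplane by (intro negligible_Union) auto
  then have "\<not> U \<subseteq> (\<Union>v\<in>V - {0}. {x. v \<bullet> x = 0})"
    using open_not_negligible[OF assms(1,2)] negligible_subset by blast
  then obtain c where "c \<in> U" "\<forall>v\<in>V - {0}. v \<bullet> c \<noteq> 0" by auto
  then show ?thesis using that[of c] by (auto simp: inner_commute)
qed

text \<open>The vectors that are positive on all of \<open>P\<close> form an open set, and each of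
  them defines \<open>P\<close>, so a defining vector can be moved off finitely many
  hyperplanes.\<close>

lemma generic_positive_functional:
  fixes \<Phi> V :: "'a::euclidean_space set"
  assumes R: "root_system \<Phi>" and P: "positive_system \<Phi> P" and V: "finite V"
  obtains c where "P = {\<gamma> \<in> \<Phi>. c \<bullet> \<gamma> > 0}" "\<And>\<gamma>. \<gamma> \<in> \<Phi> \<Longrightarrow> c \<bullet> \<gamma> \<noteq> 0"
    "\<And>v. v \<in> V \<Longrightarrow> v \<noteq> 0 \<Longrightarrow> c \<bullet> v \<noteq> 0"
proof -
  obtain c0 where c0: "P = {\<gamma> \<in> \<Phi>. c0 \<bullet> \<gamma> > 0}" using positive_systemE[OF P] by metis
  have "finite P" using R c0 unfolding root_system_def by simp
  have "open (\<Inter>\<gamma>\<in>P. {x. \<gamma> \<bullet> x > 0})"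
    using \<open>finite P\<close> by (intro open_INT) (auto simp: open_halfspace_gt)
  moreover have "c0 \<in> (\<Inter>\<gamma>\<in>P. {x. \<gamma> \<bullet> x > 0})" by (auto simp: c0 inner_commute)
  ultimately obtain c where c: "c \<in> (\<Inter>\<gamma>\<in>P. {x. \<gamma> \<bullet> x > 0})"
    and cV: "\<And>v. v \<in> V \<Longrightarrow> v \<noteq> 0 \<Longrightarrow> c \<bullet> v \<noteq> 0"
    using open_avoiding_hyperplanes[OF _ _ V] by (metis empty_iff)
  have pos: "c \<bullet> \<gamma> > 0" if "\<gamma> \<in> P" for \<gamma> using c that by (auto simp: inner_commute)
  have neg: "c \<bullet> \<gamma> < 0" if "\<gamma> \<in> \<Phi>" "\<gamma> \<notin> P" for \<gamma>
    using positive_system_cases[OF R P that(1)] that(2) pos[of "- \<gamma>"] by auto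
  show ?thesis
  proof (rule that[of c])
    show "P = {\<gamma> \<in> \<Phi>. c \<bullet> \<gamma> > 0}" using pos neg c0 by force
    show "c \<bullet> \<gamma> \<noteq> 0" if "\<gamma> \<in> \<Phi>" for \<gamma> using pos neg that by force
  qed (rule cV)
qed

text \<open>The functional \<open>x + e *\<^sub>R c\<close> realises this order for small
  \<open>e > 0\<close>: on the finitely many roots its sign is that of \<open>x\<close> wherever
  \<open>x\<close> does not vanish, and that of \<open>c\<close> elsewhere.\<close>

lemma lexicographic_positive_system:
  assumes R: "root_system \<Phi>" and c: "\<And>\<gamma>. \<gamma> \<in> \<Phi> \<Longrightarrow> c \<bullet> \<gamma> \<noteq> 0"
  shows "positive_system \<Phi> {\<gamma> \<in> \<Phi>. x \<bullet> \<gamma> > 0 \<or> x \<bullet> \<gamma> = 0 \<and> c \<bullet> \<gamma> > 0}"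
proof -
  have fin: "finite \<Phi>" using R unfolding root_system_def by blast
  have "\<forall>\<^sub>F e in at_right 0. \<bar>e * (c \<bullet> \<gamma>)\<bar> < \<bar>x \<bullet> \<gamma>\<bar>" if "x \<bullet> \<gamma> \<noteq> 0" for \<gamma>
  proof (rule order_tendstoD)
    show "((\<lambda>e. \<bar>e * (c \<bullet> \<gamma>)\<bar>) \<longlongrightarrow> 0) (at_right 0)" by (auto intro!: tendsto_eq_intros)
    show "0 < \<bar>x \<bullet> \<gamma>\<bar>" using that by simp
  qed
  then have "\<forall>\<^sub>F e in at_right 0. \<forall>\<gamma>\<in>\<Phi>. x \<bullet> \<gamma> \<noteq> 0 \<longrightarrow> \<bar>e * (c \<bullet> \<gamma>)\<bar> < \<bar>x \<bullet> \<gamma>\<bar>"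
    using fin by (subst eventually_ball_finite_distrib) auto
  then have "\<forall>\<^sub>F e in at_right 0. e > 0 \<and> (\<forall>\<gamma>\<in>\<Phi>. x \<bullet> \<gamma> \<noteq> 0 \<longrightarrow> \<bar>e * (c \<bullet> \<gamma>)\<bar> < \<bar>x \<bullet> \<gamma>\<bar>)"
    by (intro eventually_conj eventually_at_right_less)
  then obtain e :: real where e: "e > 0"
    and small: "\<And>\<gamma>. \<gamma> \<in> \<Phi> \<Longrightarrow> x \<bullet> \<gamma> \<noteq> 0 \<Longrightarrow> \<bar>e * (c \<bullet> \<gamma>)\<bar> < \<bar>x \<bullet> \<gamma>\<bar>"
    using eventually_happens'[OF trivial_limit_at_right_real] by blast
  let ?h = "x + e *\<^sub>R c"
  have sgn: "?h \<bullet> \<gamma> \<noteq> 0 \<and> (?h \<bullet> \<gamma> > 0 \<longleftrightarrow> x \<bullet> \<gamma> > 0 \<or> x \<bullet> \<gamma> = 0 \<and> c \<bullet> \<gamma> > 0)" if "\<gamma> \<in> \<Phi>" for \<gamma>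
  proof (cases "x \<bullet> \<gamma> = 0")
    case True
    then show ?thesis using c[OF that] e by (simp add: inner_add_left zero_less_mult_iff)
  next
    case False
    then show ?thesis using small[OF that False] by (simp add: inner_add_left) linarith
  qed
  show ?thesis unfolding positive_system_def by (rule exI[of _ ?h]) (use sgn in auto)
qed

text \<open>The elements of \<open>A\<close> are lexicographically positive for \<open>x\<close> followed by the coefficient of \<open>\<beta>\<close>,
  but both vanish on \<open>\<alpha>\<close>.\<close>

lemma extremal_on_rank_two_face:
  assumes CS: "(\<alpha> \<bullet> \<beta>)\<^sup>2 < (\<alpha> \<bullet> \<alpha>) * (\<beta> \<bullet> \<beta>)" and x: "x \<bullet> \<alpha> = 0" "x \<bullet> \<beta> = 0"
    and A: "\<And>\<gamma>. \<gamma> \<in> A \<Longrightarrow> x \<bullet> \<gamma> > 0 \<or> (\<exists>u v. \<gamma> = u *\<^sub>R \<alpha> + v *\<^sub>R \<beta> \<and> v > 0)"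
  shows "\<alpha> \<notin> convex_cone hull A"
proof
  \<comment> \<open>The origin is inserted because every convex cone contains it; \<alpha> itself is
    nonzero.\<close>
  let ?K = "insert 0 {\<gamma>. x \<bullet> \<gamma> > 0 \<or> (\<exists>u v. \<gamma> = u *\<^sub>R \<alpha> + v *\<^sub>R \<beta> \<and> v > 0)}"
  assume "\<alpha> \<in> convex_cone hull A"
  moreover have "convex_cone hull A \<subseteq> ?K"
  proof (rule hull_minimal)
    show "A \<subseteq> ?K" using A by blast
    have nonneg: "x \<bullet> y \<ge> 0" if "y \<in> ?K" for y using that by (auto simp: inner_add_right x)
    have sum: "y + z \<in> ?K" if yz: "y \<in> ?K" "z \<in> ?K" for y z
    proof -
      consider "y = 0 \<or> z = 0" | "x \<bullet> y > 0 \<or> x \<bullet> z > 0"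
        | u v u' v' where "y = u *\<^sub>R \<alpha> + v *\<^sub>R \<beta>" "v > 0" "z = u' *\<^sub>R \<alpha> + v' *\<^sub>R \<beta>" "v' > 0"
        using yz by blast
      then show ?thesis
      proof cases
        case 3
        then have "y + z = (u + u') *\<^sub>R \<alpha> + (v + v') *\<^sub>R \<beta>" "v + v' > 0"
          by (simp_all add: algebra_simps)
        then show ?thesis by blast
      next
        case 2
        then have "x \<bullet> (y + z) > 0" using nonneg[OF yz(1)] nonneg[OF yz(2)] by (auto simp: inner_add_right)
        then show ?thesis by blast
      next
        case 1
        then show ?thesis using yz by (elim disjE) (simp_all only: add_0_left add_0_right)
      qed
    qed
    moreover have "k *\<^sub>R y \<in> ?K" if "y \<in> ?K" "k \<ge> 0" for y and k :: real
    proof (cases "k = 0 \<or> y = 0 \<or> x \<bullet> y > 0")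
      case False
      then obtain u v where "y = u *\<^sub>R \<alpha> + v *\<^sub>R \<beta>" "v > 0" using \<open>y \<in> ?K\<close> by auto
      then have "k *\<^sub>R y = (k * u) *\<^sub>R \<alpha> + (k * v) *\<^sub>R \<beta>" "k * v > 0"
        using False that by (simp_all add: algebra_simps)
      then show ?thesis by blast
    next
      case True
      then have "k *\<^sub>R y = 0 \<or> x \<bullet> (k *\<^sub>R y) > 0" using that(2) by auto
      then show ?thesis by blast
    qed
    ultimately show "convex_cone ?K" by (simp add: convex_cone_iff)
  qed
  ultimately have "\<alpha> \<in> ?K" by blast
  moreover have "\<alpha> \<noteq> 0" using CS by auto
  ultimately obtain u v where "\<alpha> = u *\<^sub>R \<alpha> + v *\<^sub>R \<beta>" "v > 0" using x by auto
  then show False using strict_Cauchy_Schwarz_independent(2)[OF CS, of "u - 1" v]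
    by (simp add: algebra_simps)
qed

text \<open>The conclusion covers every simple system of \<open>Q\<close>, so that it can be applied
  to the image of the given one under the Weyl group.\<close>

lemma exists_positive_system_meeting_in:
  fixes \<Phi> :: "'a::euclidean_space set"
  assumes R: "root_system \<Phi>" and C: "crystallographic \<Phi>" and P: "positive_system \<Phi> P"
    and \<alpha>\<beta>: "\<alpha> \<in> P" "\<beta> \<in> P" and I: "incomparable_roots P \<alpha> \<beta>"
  shows "\<exists>Q. positive_system \<Phi> Q \<and> (\<forall>\<Gamma>. simple_system Q \<Gamma> \<longrightarrow> \<Gamma> \<inter> P = {\<alpha>, \<beta>})"
proof -
  note ne = incomparable_roots_obtuse(1)[OF R C P \<alpha>\<beta> I]
  note ob = incomparable_roots_obtuse(2)[OF R C P \<alpha>\<beta> I]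
  note CS = positive_roots_strict_Cauchy_Schwarz[OF R P \<alpha>\<beta> ne]
  have I': "incomparable_roots P \<beta> \<alpha>" using I unfolding incomparable_roots_def by blast
  \<comment> \<open>\<open>D\<close> is the Gram determinant, and by Cramer's rule
    \<open>p \<gamma>\<close> and \<open>q \<gamma>\<close> are the coefficients of the orthogonal
    projection of \<gamma> to the span of \<alpha> and \<beta>.\<close>
  define D where "D = (\<alpha> \<bullet> \<alpha>) * (\<beta> \<bullet> \<beta>) - (\<alpha> \<bullet> \<beta>)\<^sup>2"
  have D: "D > 0" using CS by (simp add: D_def)
  define p where "p \<gamma> = ((\<beta> \<bullet> \<beta>) * (\<gamma> \<bullet> \<alpha>) - (\<alpha> \<bullet> \<beta>) * (\<gamma> \<bullet> \<beta>)) / D" for \<gamma>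
  define q where "q \<gamma> = ((\<alpha> \<bullet> \<alpha>) * (\<gamma> \<bullet> \<beta>) - (\<alpha> \<bullet> \<beta>) * (\<gamma> \<bullet> \<alpha>)) / D" for \<gamma>
  \<comment> \<open>the component of \<open>\<gamma>\<close> orthogonal to \<open>\<alpha>\<close> and \<open>\<beta>\<close>\<close>
  define r where "r \<gamma> = \<gamma> - p \<gamma> *\<^sub>R \<alpha> - q \<gamma> *\<^sub>R \<beta>" for \<gamma>
  \<comment> \<open>The projection \<open>r\<close> is self-adjoint, so
    \<open>x \<bullet> \<gamma> = - (c \<bullet> r \<gamma>)\<close> for the \<open>x\<close> below.
    Genericity of \<open>c\<close> on the vectors \<open>r \<gamma>\<close> ensures that the only
    roots orthogonal to \<open>x\<close> are those spanned by \<alpha> and \<beta>.\<close>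
  have "finite (r ` \<Phi>)" using R unfolding root_system_def by simp
  then obtain c where c: "P = {\<gamma> \<in> \<Phi>. c \<bullet> \<gamma> > 0}" "\<And>\<gamma>. \<gamma> \<in> \<Phi> \<Longrightarrow> c \<bullet> \<gamma> \<noteq> 0"
    and "\<And>v. v \<in> r ` \<Phi> \<Longrightarrow> v \<noteq> 0 \<Longrightarrow> c \<bullet> v \<noteq> 0"
    by (rule generic_positive_functional[OF R P]) metis
  then have generic: "c \<bullet> r \<gamma> = 0 \<Longrightarrow> \<gamma> \<in> \<Phi> \<Longrightarrow> r \<gamma> = 0" for \<gamma> by blast
  have mem: "\<alpha> \<in> \<Phi>" "\<beta> \<in> \<Phi>" and cpos: "c \<bullet> \<alpha> > 0" "c \<bullet> \<beta> > 0" using \<alpha>\<beta> c(1) by auto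
  define x where "x = - r c"
  have x: "x \<bullet> \<alpha> = 0" "x \<bullet> \<beta> = 0"
  proof -
    have Dpq: "D * p c = (\<beta> \<bullet> \<beta>) * (c \<bullet> \<alpha>) - (\<alpha> \<bullet> \<beta>) * (c \<bullet> \<beta>)"
      "D * q c = (\<alpha> \<bullet> \<alpha>) * (c \<bullet> \<beta>) - (\<alpha> \<bullet> \<beta>) * (c \<bullet> \<alpha>)"
      using D by (simp_all add: p_def q_def)
    have "r c \<bullet> \<alpha> = c \<bullet> \<alpha> - p c * (\<alpha> \<bullet> \<alpha>) - q c * (\<alpha> \<bullet> \<beta>)"
      "r c \<bullet> \<beta> = c \<bullet> \<beta> - p c * (\<alpha> \<bullet> \<beta>) - q c * (\<beta> \<bullet> \<beta>)"
      by (simp_all add: r_def inner_diff_left inner_commute[of \<beta> \<alpha>])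
    then have "D * (r c \<bullet> \<alpha>) = 0" "D * (r c \<bullet> \<beta>) = 0"
      using Dpq unfolding D_def by algebra+
    then show "x \<bullet> \<alpha> = 0" "x \<bullet> \<beta> = 0" using D by (auto simp: x_def)
  qed
  have selfadj: "x \<bullet> \<gamma> = - (c \<bullet> r \<gamma>)" for \<gamma>
    by (simp add: x_def r_def p_def q_def inner_diff_left inner_diff_right inner_commute
        diff_divide_distrib algebra_simps)
  have span: "\<gamma> = p \<gamma> *\<^sub>R \<alpha> + q \<gamma> *\<^sub>R \<beta>" if "\<gamma> \<in> \<Phi>" "x \<bullet> \<gamma> = 0" for \<gamma>
    using generic[of \<gamma>] that by (simp add: selfadj r_def algebra_simps)
  \<comment> \<open>Both numerators are positive, since \<open>c\<close> is positive on \<alpha> and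
    \<beta> and \<open>\<alpha> \<bullet> \<beta> \<le> 0\<close>.\<close>
  have pq: "p c > 0" "q c > 0"
  proof -
    have "\<alpha> \<bullet> \<alpha> > 0" "\<beta> \<bullet> \<beta> > 0" using root_nonzero[OF R] mem by auto
    then have "(\<beta> \<bullet> \<beta>) * (c \<bullet> \<alpha>) > 0" "(\<alpha> \<bullet> \<alpha>) * (c \<bullet> \<beta>) > 0"
      "(\<alpha> \<bullet> \<beta>) * (c \<bullet> \<alpha>) \<le> 0" "(\<alpha> \<bullet> \<beta>) * (c \<bullet> \<beta>) \<le> 0"
      using cpos ob by (simp_all add: mult_nonpos_nonneg)
    then show "p c > 0" "q c > 0" using D by (simp_all add: p_def q_def)
  qed
  define Q where "Q = {\<gamma> \<in> \<Phi>. x \<bullet> \<gamma> > 0 \<or> x \<bullet> \<gamma> = 0 \<and> c \<bullet> \<gamma> > 0}"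
  have QP: "positive_system \<Phi> Q" unfolding Q_def by (rule lexicographic_positive_system[OF R c(2)])
  \<comment> \<open>Opposite signs are excluded by the rank-two lemma, applied in both orders; two
    nonpositive coefficients contradict \<open>c \<bullet> \<gamma> > 0\<close>.\<close>
  have nonneg: "p \<gamma> \<ge> 0 \<and> q \<gamma> \<ge> 0" if "\<gamma> \<in> \<Phi>" "x \<bullet> \<gamma> = 0" "c \<bullet> \<gamma> > 0" for \<gamma>
  proof -
    note eq = span[OF that(1,2)]
    have "\<not> (p \<gamma> > 0 \<and> - q \<gamma> > 0)"
      using incomparable_roots_simple_in_rank_two[OF R C P \<alpha>\<beta> I, of "p \<gamma>" "- q \<gamma>"] eq that(1) by auto
    moreover have "\<not> (q \<gamma> > 0 \<and> - p \<gamma> > 0)"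
      using incomparable_roots_simple_in_rank_two[OF R C P \<alpha>\<beta>(2,1) I', of "q \<gamma>" "- p \<gamma>"] eq that(1)
      by (auto simp: add.commute)
    moreover have "p \<gamma> * (c \<bullet> \<alpha>) + q \<gamma> * (c \<bullet> \<beta>) > 0"
      using that(3) eq by (metis inner_add_right inner_scaleR_right)
    moreover have "p \<gamma> * (c \<bullet> \<alpha>) \<le> 0" if "p \<gamma> \<le> 0" using that cpos by (simp add: mult_nonpos_nonneg)
    moreover have "q \<gamma> * (c \<bullet> \<beta>) \<le> 0" if "q \<gamma> \<le> 0" using that cpos by (simp add: mult_nonpos_nonneg)
    ultimately show ?thesis by linarith
  qed
  have multiple: "\<gamma> = \<delta>" if "\<gamma> \<in> \<Phi>" "\<delta> \<in> \<Phi>" "\<gamma> = t *\<^sub>R \<delta>" "c \<bullet> \<gamma> > 0" "c \<bullet> \<delta> > 0" for \<gamma> \<delta> t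
    using root_multiple[OF R that(2), of t] that by auto
  have \<alpha>ext: "\<alpha> \<notin> convex_cone hull (Q - {\<alpha>})"
  proof (rule extremal_on_rank_two_face[OF CS x])
    fix \<gamma> assume \<gamma>: "\<gamma> \<in> Q - {\<alpha>}"
    show "x \<bullet> \<gamma> > 0 \<or> (\<exists>u v. \<gamma> = u *\<^sub>R \<alpha> + v *\<^sub>R \<beta> \<and> v > 0)"
    proof (cases "x \<bullet> \<gamma> = 0")
      case True
      then have g: "\<gamma> \<in> \<Phi>" "c \<bullet> \<gamma> > 0" "\<gamma> \<noteq> \<alpha>" using \<gamma> by (auto simp: Q_def)
      \<comment> \<open>With \<open>q \<gamma> = 0\<close> the root would be a multiple of \<alpha>
        on which \<open>c\<close> is positive, hence \<alpha> itself.\<close>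
      have "q \<gamma> \<noteq> 0" using multiple[OF g(1) mem(1), of "p \<gamma>"] span[OF g(1) True] g cpos by auto
      then show ?thesis using nonneg[OF g(1) True g(2)] span[OF g(1) True] by force
    qed (use \<gamma> in \<open>auto simp: Q_def\<close>)
  qed
  have \<beta>ext: "\<beta> \<notin> convex_cone hull (Q - {\<beta>})"
  proof (rule extremal_on_rank_two_face[of \<beta> \<alpha>])
    fix \<gamma> assume \<gamma>: "\<gamma> \<in> Q - {\<beta>}"
    show "x \<bullet> \<gamma> > 0 \<or> (\<exists>u v. \<gamma> = u *\<^sub>R \<beta> + v *\<^sub>R \<alpha> \<and> v > 0)"
    proof (cases "x \<bullet> \<gamma> = 0")
      case True
      then have g: "\<gamma> \<in> \<Phi>" "c \<bullet> \<gamma> > 0" "\<gamma> \<noteq> \<beta>" using \<gamma> by (auto simp: Q_def)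
      have "p \<gamma> \<noteq> 0" using multiple[OF g(1) mem(2), of "q \<gamma>"] span[OF g(1) True] g cpos by auto
      then show ?thesis using nonneg[OF g(1) True g(2)] span[OF g(1) True]
        by (metis add.commute less_eq_real_def)
    qed (use \<gamma> in \<open>auto simp: Q_def\<close>)
  qed (use CS x in \<open>simp_all add: inner_commute mult.commute\<close>)
  have "\<Gamma> \<inter> P = {\<alpha>, \<beta>}" if S: "simple_system Q \<Gamma>" for \<Gamma>
  proof
    have "\<alpha> \<in> Q" "\<beta> \<in> Q" using mem x cpos by (auto simp: Q_def)
    then have G: "\<alpha> \<in> \<Gamma>" "\<beta> \<in> \<Gamma>" using extremal_in_simple_system[OF S] \<alpha>ext \<beta>ext by auto
    then show "{\<alpha>, \<beta>} \<subseteq> \<Gamma> \<inter> P" using \<alpha>\<beta> by blast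
    show "\<Gamma> \<inter> P \<subseteq> {\<alpha>, \<beta>}"
    proof (rule ccontr)
      assume "\<not> \<Gamma> \<inter> P \<subseteq> {\<alpha>, \<beta>}"
      then obtain \<gamma> where g: "\<gamma> \<in> \<Gamma>" "\<gamma> \<in> P" "\<gamma> \<noteq> \<alpha>" "\<gamma> \<noteq> \<beta>" by blast
      have "\<alpha> \<bullet> \<gamma> \<le> 0" "\<beta> \<bullet> \<gamma> \<le> 0" using simple_roots_obtuse[OF R C QP S] G g by metis+
      then have "p c * (\<alpha> \<bullet> \<gamma>) \<le> 0" "q c * (\<beta> \<bullet> \<gamma>) \<le> 0" using pq by (simp_all add: mult_nonneg_nonpos)
      moreover have "x \<bullet> \<gamma> = - (c \<bullet> \<gamma>) + p c * (\<alpha> \<bullet> \<gamma>) + q c * (\<beta> \<bullet> \<gamma>)"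
        by (simp add: x_def r_def inner_diff_left)
      moreover have "c \<bullet> \<gamma> > 0" using g(2) c(1) by blast
      moreover have "\<gamma> \<in> Q" using S g(1) unfolding simple_system_def by blast
      then have "x \<bullet> \<gamma> \<ge> 0" by (auto simp: Q_def)
      ultimately show False by linarith
    qed
  qed
  then show ?thesis using QP by blast
qed

section \<open>Transport of the given simple system to \<open>Q\<close>\<close>

theorem theorem6p11:
  fixes \<Phi> P \<Delta> :: "(real ^ 'n) set" and \<alpha> \<beta> :: "real ^ 'n"
  assumes "root_system \<Phi>" and "irreducible_roots \<Phi>" and "crystallographic \<Phi>"
    and "positive_system \<Phi> P" and "simple_system P \<Delta>"
    and "\<alpha> \<in> P" and "\<beta> \<in> P" and "incomparable_roots P \<alpha> \<beta>"
  shows "\<exists>w \<in> weyl_group \<Phi>. w ` \<Delta> \<inter> P = {\<alpha>, \<beta>}"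
proof -
  obtain Q where Q: "positive_system \<Phi> Q" "\<And>\<Gamma>. simple_system Q \<Gamma> \<Longrightarrow> \<Gamma> \<inter> P = {\<alpha>, \<beta>}"
    using exists_positive_system_meeting_in[OF assms(1,3,4,6-8)] by blast
  obtain w where w: "w \<in> weyl_group \<Phi>" "w ` P = Q"
    using weyl_group_transitive_on_positive_systems[OF assms(1,4) Q(1)] by blast
  \<comment> \<open>An injective linear map preserves cone hulls and the minimality of generators,
    so \<open>w\<close> carries \<Delta> to a simple system of \<open>Q\<close>.\<close>
  have "inj w"
    using weyl_group_properties(1)[OF assms(1) w(1)] by (simp add: BijGroup_def Bij_def bij_betw_def)
  then have "simple_system Q (w ` \<Delta>)"
    using simple_system_linear_image[OF assms(5)] weyl_group_properties(2)[OF assms(1) w(1)] w(2) by metis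
  then show ?thesis using Q(2) w(1) by blast
qed

end
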